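(* Let $(L,A,[\,\cdot\,,\ldots,\cdot\,],\rho)$ be an $n$-Lie--Rinehart algebra and $V=\operatorname{Rad}(\rho)$ its anchor radical. Then the $n$-Lie bracket of $L$, restricted to $V$, is $A$-multilinear, and $(V,A,[\,\cdot\,,\ldots,\cdot\,])$ is an $n$-Lie algebra over $A$ (i.e. $V$ is an $A$-submodule of $L$, the bracket restricts to an alternating $A$-multilinear map $V^n\to V$, and this map satisfies the Filippov identity).
   Context: $K$ is a field of characteristic zero, $A$ is a commutative associative $K$-algebra, $n\ge 2$ is an integer, and $\operatorname{Der}_K(A)$ is the $A$-module of $K$-linear derivations of $A$, with commutator bracket. An $n$-Lie algebra over $K$ is a $K$-vector space $L$ with an alternating $K$-multilinear bracket $[\,\cdot\,,\ldots,\cdot\,]:L^n\to L$ satisfying the Filippov identity $[x_1,\ldots,x_{n-1},[y_1,\ldots,y_n]]=\sum_{i=1}^n[y_1,\ldots,[x_1,\ldots,x_{n-1},y_i],\ldots,y_n]$. For $X=x_1\wedge\cdots\wedge x_{n-1}$ and $Y=y_1\wedge\cdots\wedge y_{n-1}$ (fundamental elements) put $[X,z]=[x_1,\ldots,x_{n-1},z]$ and $X\circ Y=\sum_{i=1}^{n-1}y_1\wedge\cdots\wedge[X,y_i]\wedge\cdots\wedge y_{n-1}$. An $n$-Lie--Rinehart algebra over $A$ is a quadruple $(L,A,[\,\cdot\,,\ldots,\cdot\,],\rho)$ such that: (i) $L$ is an $A$-module and an $n$-Lie algebra over $K$; (ii)--(iii) $\rho:\bigwedge_A^{n-1}L\to\operatorname{Der}_K(A)$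 (the anchor), regarded as an alternating $A$-multilinear map $\rho(x_1,\ldots,x_{n-1})=\rho(x_1\wedge\cdots\wedge x_{n-1})$, satisfies $[\rho(X),\rho(Y)]=\rho(X\circ Y)$ for all fundamental elements $X,Y$ (with chosen representatives $x_1,\ldots,x_{n-1}$ and $y_1,\ldots,y_{n-1}$); (iv) $[x_1,\ldots,x_{n-1},ay]=a[x_1,\ldots,x_{n-1},y]+\rho(x_1,\ldots,x_{n-1})(a)\,y$ for all $x_j,y\in L$, $a\in A$. The anchor radical is $\operatorname{Rad}(\rho)=\{u\in L:\rho(u,x_2,\ldots,x_{n-1})=0\ \text{for all }x_2,\ldots,x_{n-1}\in L\}$. *)

theory Defs
  imports Complex_Main
begin

text \<open>
  An argument tuple of an \<open>n\<close>-ary map is a list of length \<open>n\<close>; nothing is assumed about the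
  map on lists of any other length.  All algebraic structure lives on types of class
  \<^class>\<open>ab_group_add\<close> (\<^class>\<open>comm_ring_1\<close> for \<open>A\<close>), and the actions of scalars
  are explicit functions.
\<close>

definition comm_algebra :: "('k::field \<Rightarrow> 'a::comm_ring_1 \<Rightarrow> 'a) \<Rightarrow> bool"
  where "comm_algebra scale \<longleftrightarrow>
    vector_space scale \<and> (\<forall>k a b. scale k (a * b) = scale k a * b)"

definition derivations :: "('k::field \<Rightarrow> 'a::comm_ring_1 \<Rightarrow> 'a) \<Rightarrow> ('a \<Rightarrow> 'a) set"
  where "derivations scale =
    {D. Vector_Spaces.linear scale scale D \<and> (\<forall>a b. D (a * b) = a * D b + D a * b)}"

definition multilinear_on ::
    "('r::comm_ring_1 \<Rightarrow> 'm::ab_group_add \<Rightarrow> 'm) \<Rightarrow> ('r \<Rightarrow> 'p::ab_group_add \<Rightarrow> 'p) \<Rightarrow>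
      'm set \<Rightarrow> nat \<Rightarrow> ('m list \<Rightarrow> 'p) \<Rightarrow> bool"
  where "multilinear_on scale1 scale2 V n f \<longleftrightarrow>
    (\<forall>xs i. length xs = n \<and> set xs \<subseteq> V \<and> i < n \<longrightarrow>
      (\<forall>x\<in>V. \<forall>y\<in>V. f (xs[i := x + y]) = f (xs[i := x]) + f (xs[i := y])) \<and>
      (\<forall>r. \<forall>x\<in>V. f (xs[i := scale1 r x]) = scale2 r (f (xs[i := x]))))"

definition alternating_on :: "'m set \<Rightarrow> nat \<Rightarrow> ('m list \<Rightarrow> 'p::zero) \<Rightarrow> bool"
  where "alternating_on V n f \<longleftrightarrow>
    (\<forall>xs i j. length xs = n \<and> set xs \<subseteq> V \<and> i < n \<and> j < n \<and> i \<noteq> j \<and> xs ! i = xs ! j \<longrightarrow>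
      f xs = 0)"

text \<open>An \<open>n\<close>-Lie algebra over a commutative ring whose carrier is a submodule \<open>V\<close> of the
  ambient module; over a field with \<open>V = UNIV\<close> this is an ordinary \<open>n\<close>-Lie algebra.\<close>

locale n_Lie_algebra =
  fixes scale :: "'r::comm_ring_1 \<Rightarrow> 'l::ab_group_add \<Rightarrow> 'l"
    and V :: "'l set"
    and n :: nat
    and br :: "'l list \<Rightarrow> 'l"
  assumes module: "module scale"
    and subspace: "module.subspace scale V"
    and closed: "\<lbrakk>length xs = n; set xs \<subseteq> V\<rbrakk> \<Longrightarrow> br xs \<in> V"
    and multilinear: "multilinear_on scale scale V n br"
    and alternating: "alternating_on V n br"
    and Filippov: "\<lbrakk>length xs = n - 1; length ys = n; set xs \<subseteq> V; set ys \<subseteq> V\<rbrakk> \<Longrightarrow>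
      br (xs @ [br ys]) = (\<Sum>i<n. br (ys[i := br (xs @ [ys ! i])]))"

text \<open>
  The anchor is given as an alternating \<open>A\<close>-multilinear map on tuples of length \<open>n - 1\<close>, the
  module structure of the derivations being pointwise.  In \<open>anchor_hom\<close> the left-hand side is
  the commutator \<open>[\<rho>(X), \<rho>(Y)]\<close> and the right-hand side is \<open>\<rho>(X \<circ> Y)\<close>, i.e.\ the sum of
  \<open>\<rho>(y\<^sub>1, \<dots>, [X, y\<^sub>i], \<dots>, y\<^bsub>n-1\<^esub>)\<close> over \<open>i\<close>, both evaluated at \<open>a\<close>.
\<close>

locale n_Lie_Rinehart_algebra =
  fixes scaleKA :: "'k::field_char_0 \<Rightarrow> 'a::comm_ring_1 \<Rightarrow> 'a"
    and scaleKL :: "'k \<Rightarrow> 'l::ab_group_add \<Rightarrow> 'l"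
    and scaleAL :: "'a \<Rightarrow> 'l \<Rightarrow> 'l"
    and n :: nat
    and br :: "'l list \<Rightarrow> 'l"
    and \<rho> :: "'l list \<Rightarrow> 'a \<Rightarrow> 'a"
  assumes algebra: "comm_algebra scaleKA"
    and module: "module scaleAL"
    and scale_compat: "scaleAL (scaleKA k a) x = scaleKL k (scaleAL a x)"
    and n_Lie: "n_Lie_algebra scaleKL UNIV n br"
    and anchor_derivation: "length xs = n - 1 \<Longrightarrow> \<rho> xs \<in> derivations scaleKA"
    and anchor_multilinear: "multilinear_on scaleAL (*) UNIV (n - 1) (\<lambda>xs. \<rho> xs a)"
    and anchor_alternating: "alternating_on UNIV (n - 1) (\<lambda>xs. \<rho> xs a)"
    and anchor_hom: "\<lbrakk>length xs = n - 1; length ys = n - 1\<rbrakk> \<Longrightarrow>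
      \<rho> xs (\<rho> ys a) - \<rho> ys (\<rho> xs a) = (\<Sum>i<n - 1. \<rho> (ys[i := br (xs @ [ys ! i])]) a)"
    and Leibniz: "length xs = n - 1 \<Longrightarrow>
      br (xs @ [scaleAL a y]) = scaleAL a (br (xs @ [y])) + scaleAL (\<rho> xs a) y"

definition anchor_radical :: "nat \<Rightarrow> ('l list \<Rightarrow> 'a \<Rightarrow> 'a::zero) \<Rightarrow> 'l set"
  where "anchor_radical n \<rho> = {u. \<forall>xs. length xs = n - 2 \<longrightarrow> \<rho> (u # xs) = (\<lambda>_. 0)}"

end

(* If X = u_1 ^ ... ^ u_{n-1} has all entries in the anchor radical, then rho(X) = 0, so the
   Leibniz rule says that the bracket is A-linear in its last slot, and by antisymmetry in every
   slot.  For closure under the bracket, apply [rho(X), rho(Y)] = rho(X o Y) with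
   Y = u_n ^ y_2 ^ ... ^ y_{n-1}: the left-hand side vanishes, and every summand on the right but
   rho([u_1, ..., u_n], y_2, ..., y_{n-1}) still contains u_n and vanishes as well. *)

theory Submission
  imports Defs
begin

lemma multilinear_on_add:
  assumes "multilinear_on s t V n f" "length xs = n" "set xs \<subseteq> V" "i < n" "x \<in> V" "y \<in> V"
  shows "f (xs[i := x + y]) = f (xs[i := x]) + f (xs[i := y])"
  using assms unfolding multilinear_on_def by blast

lemma multilinear_on_scale:
  assumes "multilinear_on s t V n f" "length xs = n" "set xs \<subseteq> V" "i < n" "x \<in> V"
  shows "f (xs[i := s r x]) = t r (f (xs[i := x]))"
  using assms unfolding multilinear_on_def by blast

lemma alternating_onD:
  assumes "alternating_on V n f" "length xs = n" "set xs \<subseteq> V" "i < n" "j < n" "i \<noteq> j"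
    "xs ! i = xs ! j"
  shows "f xs = 0"
  using assms unfolding alternating_on_def by blast

lemma alternating_on_subset:
  assumes "alternating_on W n f" "V \<subseteq> W"
  shows "alternating_on V n f"
  using assms unfolding alternating_on_def by (blast intro: subset_trans)

text \<open>Polarization: expanding the vanishing value at \<open>x + y\<close> in both slots leaves
  only the two mixed terms. Additivity alone is used, so no division by 2 occurs and the lemma
  serves both the bracket over \<open>'k\<close> and the anchor over \<open>'a\<close>.\<close>

lemma alternating_multilinear_swap:
  assumes lin: "multilinear_on s t UNIV n f"
    and alt: "alternating_on UNIV n f"
    and len: "length xs = n" and i: "i < n" and j: "j < n" and "i \<noteq> j"
  shows "f (xs[i := x, j := y]) = - f (xs[i := y, j := x])"
proof -
  have diag: "f (xs[i := z, j := z]) = 0" for z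
    using alternating_onD[OF alt, of "xs[i := z, j := z]" i j] len i j \<open>i \<noteq> j\<close> by simp
  have addj: "f (xs[i := z, j := a + b]) = f (xs[i := z, j := a]) + f (xs[i := z, j := b])" for z a b
    using multilinear_on_add[OF lin, of "xs[i := z]" j] len j by simp
  have addi: "f (xs[i := a + b, j := z]) = f (xs[i := a, j := z]) + f (xs[i := b, j := z])" for z a b
    using multilinear_on_add[OF lin, of "xs[j := z]" i] len i \<open>i \<noteq> j\<close>
    by (simp add: list_update_swap[of i j])
  have "0 = f (xs[i := x + y, j := x + y])"
    by (simp add: diag)
  also have "\<dots> = f (xs[i := x, j := y]) + f (xs[i := y, j := x])"
    unfolding addi addj by (simp add: diag)
  finally show ?thesis
    by (metis eq_neg_iff_add_eq_0)
qed

context n_Lie_Rinehart_algebra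
begin

text \<open>\<open>anchor_radical\<close> constrains the first slot only; a swap with slot 0 carries
  the condition to every other slot, at the cost of a sign.\<close>

lemma anchor_eq_0_if_radical_entry:
  assumes len: "length xs = n - 1" and i: "i < n - 1" and u: "xs ! i \<in> anchor_radical n \<rho>"
  shows "\<rho> xs = (\<lambda>_. 0)"
proof -
  have hd0: "\<rho> ys a = 0" if "length ys = n - 1" "ys ! 0 = xs ! i" for ys a
  proof -
    from that i obtain zs where "ys = xs ! i # zs"
      by (cases ys) auto
    with u that show ?thesis
      unfolding anchor_radical_def by simp
  qed
  have "\<rho> xs a = 0" for a
  proof (cases "i = 0")
    case True
    with hd0 len show ?thesis by simp
  next
    case False
    \<comment> \<open>Both updates on the left rewrite an entry by itself, so the left side is
      \<open>\<rho> xs a\<close>.\<close>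
    have "\<rho> (xs[0 := xs ! 0, i := xs ! i]) a = - \<rho> (xs[0 := xs ! i, i := xs ! 0]) a"
      using alternating_multilinear_swap[OF anchor_multilinear anchor_alternating len] i False
      by simp
    also have "\<dots> = 0"
      using hd0[of "xs[0 := xs ! i, i := xs ! 0]"] len i False by simp
    finally show ?thesis by simp
  qed
  then show ?thesis by blast
qed

lemma subspace_anchor_radical:
  assumes "2 \<le> n"
  shows "module.subspace scaleAL (anchor_radical n \<rho>)"
proof -
  interpret module scaleAL by (rule module)
  have add: "\<rho> ((x + y) # zs) a = \<rho> (x # zs) a + \<rho> (y # zs) a" if "length zs = n - 2" for x y zs a
    using multilinear_on_add[OF anchor_multilinear, of "x # zs" 0] that assms by simp
  have scale: "\<rho> (scaleAL r x # zs) a = r * \<rho> (x # zs) a" if "length zs = n - 2" for r x zs a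
    using multilinear_on_scale[OF anchor_multilinear, of "x # zs" 0] that assms by simp
  have zero: "\<rho> (0 # zs) a = 0" if "length zs = n - 2" for zs a
    using scale[OF that, of 0 0] by simp
  show ?thesis
    unfolding subspace_def anchor_radical_def by (auto simp: fun_eq_iff add scale zero)
qed

lemma bracket_anchor_radical:
  assumes n: "2 \<le> n" and len: "length us = n" and us: "set us \<subseteq> anchor_radical n \<rho>"
  shows "br us \<in> anchor_radical n \<rho>"
  unfolding anchor_radical_def
proof (clarify, rule ext)
  fix zs :: "'l list" and a
  assume zs: "length zs = n - 2"
  let ?X = "butlast us" and ?u = "last us"
  have us_eq: "?X @ [?u] = us" and X: "length ?X = n - 1"
    using n len by (auto intro!: append_butlast_last_id)
  have u: "?u \<in> anchor_radical n \<rho>"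
    using us us_eq by (metis in_set_conv_decomp subsetD)
  \<comment> \<open>Since \<open>2 \<le> n\<close>, the tuple \<open>?X\<close> is nonempty, and a
    single radical entry suffices to kill its anchor.\<close>
  have "?X ! 0 \<in> anchor_radical n \<rho>"
    using us n X by (metis in_set_butlastD nth_mem subsetD zero_less_diff Suc_1 Suc_le_lessD)
  then have \<rho>X: "\<rho> ?X = (\<lambda>_. 0)"
    using anchor_eq_0_if_radical_entry[OF X, of 0] n by simp
  have Y: "length (?u # zs) = n - 1"
    using zs n by simp
  have \<rho>Y: "\<rho> (?u # zs) = (\<lambda>_. 0)"
    using u zs unfolding anchor_radical_def by blast
  \<comment> \<open>An update away from slot 0 keeps \<open>?u\<close> at the head, whatever
    \<open>w\<close> is.\<close>
  have rest: "\<rho> ((?u # zs)[i := w]) a = 0" if "i < n - 1" "i \<noteq> 0" for i w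
  proof -
    have "length ((?u # zs)[i := w]) = n - 1" "(?u # zs)[i := w] ! 0 = ?u"
      using Y that by (simp_all del: list_update.simps)
    then show ?thesis
      using anchor_eq_0_if_radical_entry[of "(?u # zs)[i := w]" 0] u that by (metis gr0I less_trans)
  qed
  have "0 = (\<Sum>i<n - 1. \<rho> ((?u # zs)[i := br (?X @ [(?u # zs) ! i])]) a)"
    using anchor_hom[OF X Y, of a] by (simp add: \<rho>X \<rho>Y)
  also have "\<dots> = (\<Sum>i\<in>{0}. \<rho> ((?u # zs)[i := br (?X @ [(?u # zs) ! i])]) a)"
    by (rule sum.mono_neutral_right) (use n rest in auto)
  also have "\<dots> = \<rho> (br us # zs) a"
    by (simp add: us_eq)
  finally show "\<rho> (br us # zs) a = 0" by simp
qed

text \<open>The correction term in \<open>Leibniz\<close> is the anchor of the other n - 1 entries,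
  so it is these that must be radical; \<open>x\<close> ranges over the whole module.\<close>

lemma bracket_scale_anchor_radical:
  assumes n: "2 \<le> n" and len: "length xs = n" and xs: "set xs \<subseteq> anchor_radical n \<rho>" and i: "i < n"
  shows "br (xs[i := scaleAL r x]) = scaleAL r (br (xs[i := x]))"
proof -
  interpret m: module scaleAL by (rule module)
  interpret L: n_Lie_algebra scaleKL UNIV n br by (rule n_Lie)
  have last: "br (ys[n - 1 := scaleAL r x]) = scaleAL r (br (ys[n - 1 := x]))"
    if ys: "length ys = n" "set ys \<subseteq> anchor_radical n \<rho>" for ys
  proof -
    \<comment> \<open>This is the shape in which \<open>Leibniz\<close> addresses the last
      slot.\<close>
    have upd: "ys[n - 1 := z] = butlast ys @ [z]" for z
      using ys n list_update_length[of "butlast ys" "last ys" "[]" z]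
      by (cases "ys = []") auto
    have "butlast ys ! 0 \<in> anchor_radical n \<rho>"
      using ys n by (metis in_set_butlastD length_butlast nth_mem subsetD zero_less_diff Suc_1 Suc_le_lessD)
    then have "\<rho> (butlast ys) = (\<lambda>_. 0)"
      using anchor_eq_0_if_radical_entry[of "butlast ys" 0] ys n by simp
    then show ?thesis
      using Leibniz[of "butlast ys" r x] ys by (simp add: upd del: One_nat_def)
  qed
  show ?thesis
  proof (cases "i = n - 1")
    case True
    with last[OF len xs] show ?thesis by simp
  next
    case False
    \<comment> \<open>Slot \<open>i\<close> receives the last entry of \<open>xs\<close>, which
      frees the last slot for \<open>z\<close>. The sign from the swap appears on both sides of the
      goal and cancels.\<close>
    let ?ys = "xs[i := xs ! (n - 1)]"
    have swap: "br (xs[i := z]) = - br (?ys[n - 1 := z])" for z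
      using alternating_multilinear_swap[OF L.multilinear L.alternating len i, of "n - 1" z "xs ! (n - 1)"]
        False n len by (metis One_nat_def diff_less less_le_trans list_update_id list_update_swap
          nth_list_update_neq zero_less_numeral zero_less_one)
    have "set ?ys \<subseteq> anchor_radical n \<rho>"
      using xs len n by (intro set_update_subsetI) (auto simp: subset_iff)
    then show ?thesis
      using last[of ?ys] len by (simp add: swap)
  qed
qed

text \<open>Additivity does not see the scalars and is inherited from the bracket over
  \<open>'k\<close>; only homogeneity over \<open>'a\<close> is new.\<close>

lemma multilinear_on_anchor_radical:
  assumes "2 \<le> n"
  shows "multilinear_on scaleAL scaleAL (anchor_radical n \<rho>) n br"
proof -
  interpret L: n_Lie_algebra scaleKL UNIV n br by (rule n_Lie)
  show ?thesis
    unfolding multilinear_on_def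
    using multilinear_on_add[OF L.multilinear] bracket_scale_anchor_radical[OF assms] by simp
qed

text \<open>Alternation and the Filippov identity are free of scalars, so they restrict from the
  whole module to the radical.\<close>

lemma n_Lie_algebra_anchor_radical:
  assumes "2 \<le> n"
  shows "n_Lie_algebra scaleAL (anchor_radical n \<rho>) n br"
proof -
  interpret L: n_Lie_algebra scaleKL UNIV n br by (rule n_Lie)
  show ?thesis
  proof (rule n_Lie_algebra.intro)
    show "alternating_on (anchor_radical n \<rho>) n br"
      by (rule alternating_on_subset[OF L.alternating]) simp
  qed (use module subspace_anchor_radical[OF assms] bracket_anchor_radical[OF assms]
      multilinear_on_anchor_radical[OF assms] L.Filippov in auto)
qed

end

theorem mainTheorem2:
  fixes scaleKA :: "'k::field_char_0 \<Rightarrow> 'a::comm_ring_1 \<Rightarrow> 'a"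
    and scaleKL :: "'k \<Rightarrow> 'l::ab_group_add \<Rightarrow> 'l"
    and scaleAL :: "'a \<Rightarrow> 'l \<Rightarrow> 'l"
    and n :: nat
    and br :: "'l list \<Rightarrow> 'l"
    and \<rho> :: "'l list \<Rightarrow> 'a \<Rightarrow> 'a"
  assumes "2 \<le> n"
    and "n_Lie_Rinehart_algebra scaleKA scaleKL scaleAL n br \<rho>"
  shows "multilinear_on scaleAL scaleAL (anchor_radical n \<rho>) n br \<and>
    n_Lie_algebra scaleAL (anchor_radical n \<rho>) n br"
  using n_Lie_Rinehart_algebra.multilinear_on_anchor_radical[OF assms(2,1)]
    n_Lie_Rinehart_algebra.n_Lie_algebra_anchor_radical[OF assms(2,1)] by blast

end
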